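(* Let $\mathcal{M}$ be a countable homogeneous structure equipped with a stationary weak independence relation, let $G=\mathrm{Aut}(\mathcal{M})$, and let $g\in G$ be such that each of $g$ and $g^{-1}$ moves both almost $R$-maximally and almost $L$-maximally. Then any element of $G$ is a product of eight conjugates of $g$.
   Context: Let $\mathcal{L}$ be a first-order relational language. A countable $\mathcal{L}$-structure $\mathcal{M}$ is homogeneous if every isomorphism between finite substructures of $\mathcal{M}$ extends to an automorphism of $\mathcal{M}$. Write $G=\mathrm{Aut}(\mathcal{M})$, $AB$ for (the substructure on) $A\cup B$, and $G_{(B)}$ for the pointwise stabiliser of a finite set $B\subseteq\mathcal{M}$. Finite tuples are identified with their underlying sets when used in the relation below. For a finite $B\subseteq\mathcal{M}$, an $n$-type over $B$ is a $G_{(B)}$-orbit on $n$-tuples of $\mathcal{M}$; $\mathrm{tp}(a/B)$ is the orbit containing $a$; $a$ realises (is a realisation of) $p$ if it lies in the orbit $p$. A ternary relation $A\perp_B C$ between finite substructures $A,B,C$ of $\mathcal{M}$ is a stationary weak independence relation if: (i) Invariance: for $g\in \mathrm{Aut}(\mathcal{M})$, $A\perp_B C$ implies $gA\perp_{gB}gC$. (ii) Monotonicity: $A\perp_B CD$ implies $A\perp_B C$ and $A\perp_{BC}D$; and $AD\perp_B C$ implies $A\perp_B C$ and $D\perp_{AB}C$. (iii) Transitivity: $A\perp_B C$ and $A\perp_{BC}D$ imply $A\perp_B D$; and $A\perp_B C$ and $D\perp_{AB}C$ imply $D\perp_B C$. (iv) Existence: if $p$ is an $n$-type over $B$ and $C$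 is a finite set, then $p$ has a realisation $a$ with $a\perp_B C$, and $p$ has a realisation $a$ with $C\perp_B a$. (v) Stationarity: if $n$-tuples $a,a'$ have the same type over $B$ and $a\perp_B C$, $a'\perp_B C$, then $a,a'$ have the same type over $BC$; and if $n$-tuples $a,a'$ have the same type over $B$ and $C\perp_B a$, $C\perp_B a'$, then $a,a'$ have the same type over $BC$. (Symmetry is not assumed.) An automorphism $g$ moves almost $R$-maximally if for every finite set $X\subseteq\mathcal{M}$, every $n$ and every $n$-type $p$ over $X$, there is a realisation $a$ of $p$ with $a\perp_X g(a)$. It moves almost $L$-maximally if for every finite $X$, every $n$ and every $n$-type $p$ over $X$, there is a realisation $a$ of $p$ with $g(a)\perp_X a$. *)

theory Defs
  imports Main "HOL-Library.Countable"
begin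

text \<open>
  A structure for a relational language has as universe a whole type \<open>'a\<close>. The relation symbols
  are the elements of a type \<open>'r\<close> (of arbitrary size), and tuples are lists. Since the language is
  relational, the finite substructures are exactly the finite subsets of \<open>'a\<close>, the empty set
  included.
\<close>

definition relational_structure :: "('r \<Rightarrow> nat) \<Rightarrow> ('r \<Rightarrow> 'a list \<Rightarrow> bool) \<Rightarrow> bool" where
  "relational_structure ar rel \<longleftrightarrow> (\<forall>r xs. rel r xs \<longrightarrow> length xs = ar r)"

definition substructure_iso ::
    "('r \<Rightarrow> 'a list \<Rightarrow> bool) \<Rightarrow> 'a set \<Rightarrow> 'a set \<Rightarrow> ('a \<Rightarrow> 'a) \<Rightarrow> bool" where
  "substructure_iso rel A B f \<longleftrightarrow>
     bij_betw f A B \<and> (\<forall>r xs. set xs \<subseteq> A \<longrightarrow> (rel r (map f xs) \<longleftrightarrow> rel r xs))"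

definition Aut :: "('r \<Rightarrow> 'a list \<Rightarrow> bool) \<Rightarrow> ('a \<Rightarrow> 'a) set" where
  "Aut rel = {g. substructure_iso rel UNIV UNIV g}"

definition homogeneous :: "('r \<Rightarrow> 'a list \<Rightarrow> bool) \<Rightarrow> bool" where
  "homogeneous rel \<longleftrightarrow>
     (\<forall>A B f. finite A \<longrightarrow> finite B \<longrightarrow> substructure_iso rel A B f \<longrightarrow>
        (\<exists>g\<in>Aut rel. \<forall>x\<in>A. g x = f x))"

definition pointwise_stabiliser :: "('r \<Rightarrow> 'a list \<Rightarrow> bool) \<Rightarrow> 'a set \<Rightarrow> ('a \<Rightarrow> 'a) set" where
  "pointwise_stabiliser rel B = {g \<in> Aut rel. \<forall>b\<in>B. g b = b}"

definition tp :: "('r \<Rightarrow> 'a list \<Rightarrow> bool) \<Rightarrow> 'a set \<Rightarrow> 'a list \<Rightarrow> 'a list set" where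
  "tp rel B a = (\<lambda>g. map g a) ` pointwise_stabiliser rel B"

definition types_over :: "('r \<Rightarrow> 'a list \<Rightarrow> bool) \<Rightarrow> nat \<Rightarrow> 'a set \<Rightarrow> 'a list set set" where
  "types_over rel n B = tp rel B ` {a. length a = n}"

text \<open>
  The relation \<open>indep A B C\<close>, written \<open>A \<bottom>\<^bsub>B\<^esub> C\<close>, is only constrained on finite sets. Its
  values at infinite arguments are irrelevant.
\<close>

locale stationary_weak_independence =
  fixes rel :: "'r \<Rightarrow> 'a list \<Rightarrow> bool"
    and indep :: "'a set \<Rightarrow> 'a set \<Rightarrow> 'a set \<Rightarrow> bool"  ("_ \<bottom>\<^bsub>_\<^esub> _" [51, 0, 51] 50)
  assumes invariance:
      "\<lbrakk>finite A; finite B; finite C; g \<in> Aut rel; A \<bottom>\<^bsub>B\<^esub> C\<rbrakk> \<Longrightarrow> (g ` A) \<bottom>\<^bsub>g ` B\<^esub> (g ` C)"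
    and monotonicity_right:
      "\<lbrakk>finite A; finite B; finite C; finite D; A \<bottom>\<^bsub>B\<^esub> (C \<union> D)\<rbrakk>
        \<Longrightarrow> A \<bottom>\<^bsub>B\<^esub> C \<and> A \<bottom>\<^bsub>B \<union> C\<^esub> D"
    and monotonicity_left:
      "\<lbrakk>finite A; finite B; finite C; finite D; (A \<union> D) \<bottom>\<^bsub>B\<^esub> C\<rbrakk>
        \<Longrightarrow> A \<bottom>\<^bsub>B\<^esub> C \<and> D \<bottom>\<^bsub>A \<union> B\<^esub> C"
    and transitivity_right:
      "\<lbrakk>finite A; finite B; finite C; finite D; A \<bottom>\<^bsub>B\<^esub> C; A \<bottom>\<^bsub>B \<union> C\<^esub> D\<rbrakk> \<Longrightarrow> A \<bottom>\<^bsub>B\<^esub> D"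
    and transitivity_left:
      "\<lbrakk>finite A; finite B; finite C; finite D; A \<bottom>\<^bsub>B\<^esub> C; D \<bottom>\<^bsub>A \<union> B\<^esub> C\<rbrakk> \<Longrightarrow> D \<bottom>\<^bsub>B\<^esub> C"
    and existence_right:
      "\<lbrakk>finite B; finite C; p \<in> types_over rel n B\<rbrakk> \<Longrightarrow> \<exists>a\<in>p. set a \<bottom>\<^bsub>B\<^esub> C"
    and existence_left:
      "\<lbrakk>finite B; finite C; p \<in> types_over rel n B\<rbrakk> \<Longrightarrow> \<exists>a\<in>p. C \<bottom>\<^bsub>B\<^esub> set a"
    and stationarity_right:
      "\<lbrakk>finite B; finite C; length a = n; length a' = n; tp rel B a = tp rel B a';
        set a \<bottom>\<^bsub>B\<^esub> C; set a' \<bottom>\<^bsub>B\<^esub> C\<rbrakk> \<Longrightarrow> tp rel (B \<union> C) a = tp rel (B \<union> C) a'"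
    and stationarity_left:
      "\<lbrakk>finite B; finite C; length a = n; length a' = n; tp rel B a = tp rel B a';
        C \<bottom>\<^bsub>B\<^esub> set a; C \<bottom>\<^bsub>B\<^esub> set a'\<rbrakk> \<Longrightarrow> tp rel (B \<union> C) a = tp rel (B \<union> C) a'"

definition moves_almost_R_maximally ::
    "('r \<Rightarrow> 'a list \<Rightarrow> bool) \<Rightarrow> ('a set \<Rightarrow> 'a set \<Rightarrow> 'a set \<Rightarrow> bool) \<Rightarrow> ('a \<Rightarrow> 'a) \<Rightarrow> bool" where
  "moves_almost_R_maximally rel indep g \<longleftrightarrow>
     (\<forall>X n. finite X \<longrightarrow> (\<forall>p\<in>types_over rel n X. \<exists>a\<in>p. indep (set a) X (set (map g a))))"

definition moves_almost_L_maximally ::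
    "('r \<Rightarrow> 'a list \<Rightarrow> bool) \<Rightarrow> ('a set \<Rightarrow> 'a set \<Rightarrow> 'a set \<Rightarrow> bool) \<Rightarrow> ('a \<Rightarrow> 'a) \<Rightarrow> bool" where
  "moves_almost_L_maximally rel indep g \<longleftrightarrow>
     (\<forall>X n. finite X \<longrightarrow> (\<forall>p\<in>types_over rel n X. \<exists>a\<in>p. indep (set (map g a)) X (set a)))"

definition conjugates :: "('r \<Rightarrow> 'a list \<Rightarrow> bool) \<Rightarrow> ('a \<Rightarrow> 'a) \<Rightarrow> ('a \<Rightarrow> 'a) set" where
  "conjugates rel g = (\<lambda>k. k \<circ> g \<circ> inv k) ` Aut rel"

end

theory Submission
  imports Defs
begin

text \<open>
  Let \<open>e\<^sub>1, \<dots>, e\<^sub>4\<close> be conjugates of \<open>g\<close> mapping finite sets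
  \<open>X\<^sub>0 \<rightarrow> X\<^sub>1 \<rightarrow> X\<^sub>2 \<rightarrow> X\<^sub>3 \<rightarrow> X\<^sub>4\<close>. If \<open>X\<^sub>0\<close> is independent from \<open>X\<^sub>2\<close> over \<open>X\<^sub>1\<close> and \<open>X\<^sub>4\<close> is
  independent from \<open>X\<^sub>2\<close> over \<open>X\<^sub>3\<close>, then after conjugating each \<open>e\<^sub>i\<close> over
  \<open>X\<^bsub>i-1\<^esub> \<union> X\<^sub>i\<close> the product takes any prescribed values on a further finite set: the outer two
  maps bring the data into independent position over \<open>X\<^sub>1\<close> and \<open>X\<^sub>3\<close>, and stationarity lets the
  inner two meet at an independent copy over \<open>X\<^sub>2\<close>. Hence the map sending four conjugators to the
  product of the conjugates takes every open set to a set that is dense in some nonempty open set.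
  The same holds for \<open>h\<close> times a product of four conjugates of \<open>g\<inverse>\<close>. Two such maps which are
  moreover dense in the whole group have a common value, by a back-and-forth construction that
  replaces the usual Baire category argument, and such a common value writes \<open>h\<close> as a product of
  eight conjugates of \<open>g\<close>.
\<close>

section \<open>The automorphism group\<close>

lemma Aut_iff: "g \<in> Aut rel \<longleftrightarrow> bij g \<and> (\<forall>r xs. rel r (map g xs) \<longleftrightarrow> rel r xs)"
  by (auto simp: Aut_def substructure_iso_def)

lemma Aut_bij: "g \<in> Aut rel \<Longrightarrow> bij g"
  by (simp add: Aut_iff)

lemma Aut_id [simp]: "id \<in> Aut rel"
  by (simp add: Aut_iff)

lemma Aut_comp [simp]: "f \<in> Aut rel \<Longrightarrow> g \<in> Aut rel \<Longrightarrow> f \<circ> g \<in> Aut rel"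
  by (simp add: Aut_iff bij_comp flip: map_map)

lemma Aut_inv_left [simp]: "g \<in> Aut rel \<Longrightarrow> inv g (g x) = x"
  using Aut_bij bij_inv_eq_iff by metis

lemma Aut_inv_right [simp]: "g \<in> Aut rel \<Longrightarrow> g (inv g x) = x"
  using Aut_bij bij_inv_eq_iff by metis

lemma Aut_inv [simp]:
  assumes "g \<in> Aut rel"
  shows "inv g \<in> Aut rel"
proof -
  have "rel r (map (inv g) xs) \<longleftrightarrow> rel r xs" for r xs
  proof -
    have "rel r (map g (map (inv g) xs)) \<longleftrightarrow> rel r (map (inv g) xs)"
      using assms by (simp add: Aut_iff del: map_map)
    moreover have "map g (map (inv g) xs) = xs"
      using assms by (simp add: comp_def)
    ultimately show ?thesis by simp
  qed
  then show ?thesis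
    using Aut_bij[OF assms] by (simp add: Aut_iff bij_imp_bij_inv)
qed

lemma Aut_inv_image_left [simp]: "g \<in> Aut rel \<Longrightarrow> inv g ` g ` A = A"
  by (simp add: image_image)

lemma Aut_inv_image_right [simp]: "g \<in> Aut rel \<Longrightarrow> g ` inv g ` A = A"
  by (simp add: image_image)

lemma Aut_inv_inv [simp]: "g \<in> Aut rel \<Longrightarrow> inv (inv g) = g"
  by (simp add: Aut_bij inv_inv_eq)

lemma stabiliser_iff: "f \<in> pointwise_stabiliser rel B \<longleftrightarrow> f \<in> Aut rel \<and> (\<forall>b\<in>B. f b = b)"
  by (simp add: pointwise_stabiliser_def)

lemma stabiliser_Aut: "f \<in> pointwise_stabiliser rel B \<Longrightarrow> f \<in> Aut rel"
  by (simp add: stabiliser_iff)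

lemma stabiliser_id [simp]: "id \<in> pointwise_stabiliser rel B"
  by (simp add: stabiliser_iff)

lemma stabiliser_comp [simp]:
  "f \<in> pointwise_stabiliser rel B \<Longrightarrow> g \<in> pointwise_stabiliser rel B
    \<Longrightarrow> f \<circ> g \<in> pointwise_stabiliser rel B"
  by (simp add: stabiliser_iff)

lemma stabiliser_inv [simp]:
  "f \<in> pointwise_stabiliser rel B \<Longrightarrow> inv f \<in> pointwise_stabiliser rel B"
  by (simp add: stabiliser_iff) (metis Aut_inv_left)

lemma stabiliser_mono: "B \<subseteq> C \<Longrightarrow> pointwise_stabiliser rel C \<subseteq> pointwise_stabiliser rel B"
  unfolding pointwise_stabiliser_def by blast

lemma stabiliser_image: "f \<in> pointwise_stabiliser rel B \<Longrightarrow> A \<subseteq> B \<Longrightarrow> f ` A = A"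
  by (force simp: stabiliser_iff)

lemma mem_tp_self: "a \<in> tp rel B a"
  unfolding tp_def by (rule image_eqI[of _ _ id]) simp_all

lemma tp_map:
  assumes f: "f \<in> pointwise_stabiliser rel B"
  shows "tp rel B (map f a) = tp rel B a"
proof
  show "tp rel B (map f a) \<subseteq> tp rel B a"
    using f by (force simp: tp_def intro: stabiliser_comp)
  show "tp rel B a \<subseteq> tp rel B (map f a)"
  proof
    fix b assume "b \<in> tp rel B a"
    then obtain g where g: "g \<in> pointwise_stabiliser rel B" "b = map g a"
      by (auto simp: tp_def)
    have "b = map (g \<circ> inv f) (map f a)"
      using g(2) Aut_inv_left[OF stabiliser_Aut[OF f]] by simp
    with f g(1) show "b \<in> tp rel B (map f a)"
      unfolding tp_def by (intro image_eqI[of _ _ "g \<circ> inv f"]) simp_all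
  qed
qed

definition conj_by :: "('a \<Rightarrow> 'a) \<Rightarrow> ('a \<Rightarrow> 'a) \<Rightarrow> 'a \<Rightarrow> 'a" where
  "conj_by k g = k \<circ> g \<circ> inv k"

lemma conj_by_apply: "conj_by k g x = k (g (inv k x))"
  by (simp add: conj_by_def)

lemma conj_by_Aut [simp]: "k \<in> Aut rel \<Longrightarrow> g \<in> Aut rel \<Longrightarrow> conj_by k g \<in> Aut rel"
  by (simp add: conj_by_def)

lemma conj_by_comp:
  "a \<in> Aut rel \<Longrightarrow> k \<in> Aut rel \<Longrightarrow> conj_by (a \<circ> k) g = conj_by a (conj_by k g)"
  by (simp add: conj_by_def Aut_bij o_inv_distrib comp_assoc)

lemma conj_by_inv:
  assumes "k \<in> Aut rel" "g \<in> Aut rel"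
  shows "conj_by k (inv g) = inv (conj_by k g)"
proof -
  have b: "bij k" "bij g" using assms by (simp_all add: Aut_bij)
  then show ?thesis
    by (simp add: conj_by_def o_inv_distrib bij_comp bij_imp_bij_inv inv_inv_eq comp_assoc)
qed

lemma conj_by_stable:
  assumes "a \<in> pointwise_stabiliser rel F" "x \<in> F" "g x \<in> F"
  shows "conj_by a g x = g x"
  using assms stabiliser_inv[OF assms(1)] by (simp add: stabiliser_iff conj_by_apply)

section \<open>Independence and moving maximally in terms of finite sets\<close>

context stationary_weak_independence
begin

abbreviation Fix :: "'a set \<Rightarrow> ('a \<Rightarrow> 'a) set" where
  "Fix B \<equiv> pointwise_stabiliser rel B"

text \<open>Realisations of the type over \<open>B\<close> of a tuple listing \<open>A\<close> are
  its images under \<open>Fix B\<close>, so statements about types become statements about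
  automorphisms moving finite sets.\<close>

lemma types_overE:
  assumes "finite A" and "\<And>n p. p \<in> types_over rel n B \<Longrightarrow> \<exists>a\<in>p. Q a"
  obtains f xs where "f \<in> Fix B" "set xs = A" "Q (map f xs)"
proof -
  obtain xs where xs: "set xs = A" using finite_list[OF assms(1)] by blast
  have "tp rel B xs \<in> types_over rel (length xs) B" by (auto simp: types_over_def)
  then obtain a where "a \<in> tp rel B xs" "Q a" using assms(2) by blast
  then show thesis using xs by (auto simp: tp_def intro: that)
qed

lemma existence:
  assumes "finite A" "finite B" "finite C"
  obtains f where "f \<in> Fix B" "(f ` A) \<bottom>\<^bsub>B\<^esub> C"
proof -
  obtain f xs where "f \<in> Fix B" "set xs = A" "set (map f xs) \<bottom>\<^bsub>B\<^esub> C"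
    using types_overE[OF assms(1), of B "\<lambda>a. set a \<bottom>\<^bsub>B\<^esub> C"] existence_right[OF assms(2,3)] by blast
  then show thesis by (intro that) auto
qed

lemma stationarity:
  assumes "finite A" "finite B" "finite C"
    and f: "f \<in> Fix B" and "A \<bottom>\<^bsub>B\<^esub> C" "(f ` A) \<bottom>\<^bsub>B\<^esub> C"
  obtains f' where "f' \<in> Fix (B \<union> C)" "\<And>x. x \<in> A \<Longrightarrow> f' x = f x"
proof -
  obtain xs where xs: "set xs = A" using finite_list[OF assms(1)] by blast
  have "tp rel (B \<union> C) xs = tp rel (B \<union> C) (map f xs)"
    by (rule stationarity_right[OF assms(2,3) refl]) (use assms xs in \<open>simp_all add: tp_map\<close>)
  then have "map f xs \<in> tp rel (B \<union> C) xs" by (simp add: mem_tp_self)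
  then show thesis using xs by (auto simp: tp_def intro: that)
qed

lemma indep_mono:
  assumes "finite A" "finite B" "finite C" "A \<bottom>\<^bsub>B\<^esub> C" "C1 \<subseteq> C" "C2 \<subseteq> C"
  shows "A \<bottom>\<^bsub>B \<union> C1\<^esub> C2"
proof -
  have fin: "finite C1" "finite C2" using assms finite_subset by blast+
  have "C1 \<union> C = C" "C2 \<union> C = C" using assms by auto
  then have "A \<bottom>\<^bsub>B \<union> C1\<^esub> (C2 \<union> C)"
    using monotonicity_right[of A B C1 C] assms fin by simp
  then show ?thesis using monotonicity_right[of A "B \<union> C1" C2 C] assms fin by simp
qed

lemma indep_mono_right:
  "\<lbrakk>finite A; finite B; finite C; A \<bottom>\<^bsub>B\<^esub> C; D \<subseteq> C\<rbrakk> \<Longrightarrow> A \<bottom>\<^bsub>B\<^esub> D"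
  using indep_mono[of A B C "{}" D] by simp

definition R_moving :: "('a \<Rightarrow> 'a) \<Rightarrow> bool" where
  "R_moving e \<longleftrightarrow> e \<in> Aut rel \<and>
     (\<forall>X A. finite X \<longrightarrow> finite A \<longrightarrow> (\<exists>f\<in>Fix X. (f ` A) \<bottom>\<^bsub>X\<^esub> (e ` f ` A)))"

definition L_moving :: "('a \<Rightarrow> 'a) \<Rightarrow> bool" where
  "L_moving e \<longleftrightarrow> e \<in> Aut rel \<and>
     (\<forall>X A. finite X \<longrightarrow> finite A \<longrightarrow> (\<exists>f\<in>Fix X. (e ` f ` A) \<bottom>\<^bsub>X\<^esub> (f ` A)))"

lemma R_movingI:
  assumes "moves_almost_R_maximally rel indep e" "e \<in> Aut rel"
  shows "R_moving e"
  unfolding R_moving_def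
proof (intro conjI allI impI)
  fix X A :: "'a set" assume fin: "finite X" "finite A"
  obtain f xs where "f \<in> Fix X" "set xs = A" "set (map f xs) \<bottom>\<^bsub>X\<^esub> set (map e (map f xs))"
    using types_overE[OF fin(2), of X "\<lambda>a. set a \<bottom>\<^bsub>X\<^esub> set (map e a)"] assms(1) fin(1)
    unfolding moves_almost_R_maximally_def by blast
  then show "\<exists>f\<in>Fix X. (f ` A) \<bottom>\<^bsub>X\<^esub> (e ` f ` A)" by (auto simp: image_comp)
qed (fact assms)

lemma L_movingI:
  assumes "moves_almost_L_maximally rel indep e" "e \<in> Aut rel"
  shows "L_moving e"
  unfolding L_moving_def
proof (intro conjI allI impI)
  fix X A :: "'a set" assume fin: "finite X" "finite A"
  obtain f xs where "f \<in> Fix X" "set xs = A" "set (map e (map f xs)) \<bottom>\<^bsub>X\<^esub> set (map f xs)"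
    using types_overE[OF fin(2), of X "\<lambda>a. set (map e a) \<bottom>\<^bsub>X\<^esub> set a"] assms(1) fin(1)
    unfolding moves_almost_L_maximally_def by blast
  then show "\<exists>f\<in>Fix X. (e ` f ` A) \<bottom>\<^bsub>X\<^esub> (f ` A)" by (auto simp: image_comp)
qed (fact assms)

lemma conj_by_stabiliser:
  assumes "k \<in> Aut rel" "f \<in> Fix (inv k ` X)"
  shows "conj_by k f \<in> Fix X"
  using assms by (simp add: stabiliser_iff conj_by_apply)

lemma conj_by_image: "k \<in> Aut rel \<Longrightarrow> conj_by k f ` A = k ` f ` inv k ` A"
  by (simp add: conj_by_def image_comp comp_assoc)

lemma conj_by_conj_by_image:
  "k \<in> Aut rel \<Longrightarrow> conj_by k g ` conj_by k f ` A = k ` g ` f ` inv k ` A"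
  by (simp add: conj_by_image)

lemma R_moving_conj:
  assumes g: "R_moving g" and k: "k \<in> Aut rel"
  shows "R_moving (conj_by k g)"
  unfolding R_moving_def
proof (intro conjI allI impI)
  show "conj_by k g \<in> Aut rel" using g k by (simp add: R_moving_def)
  fix X A :: "'a set" assume fin: "finite X" "finite A"
  then obtain f where f: "f \<in> Fix (inv k ` X)" "(f ` inv k ` A) \<bottom>\<^bsub>inv k ` X\<^esub> (g ` f ` inv k ` A)"
    using g unfolding R_moving_def by (meson finite_imageI)
  have "(k ` f ` inv k ` A) \<bottom>\<^bsub>X\<^esub> (k ` g ` f ` inv k ` A)"
    using invariance[OF _ _ _ k f(2)] fin k by simp
  then show "\<exists>f\<in>Fix X. (f ` A) \<bottom>\<^bsub>X\<^esub> (conj_by k g ` f ` A)"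
    using k conj_by_stabiliser[OF k f(1)] by (metis conj_by_image conj_by_conj_by_image)
qed

lemma L_moving_conj:
  assumes g: "L_moving g" and k: "k \<in> Aut rel"
  shows "L_moving (conj_by k g)"
  unfolding L_moving_def
proof (intro conjI allI impI)
  show "conj_by k g \<in> Aut rel" using g k by (simp add: L_moving_def)
  fix X A :: "'a set" assume fin: "finite X" "finite A"
  then obtain f where f: "f \<in> Fix (inv k ` X)" "(g ` f ` inv k ` A) \<bottom>\<^bsub>inv k ` X\<^esub> (f ` inv k ` A)"
    using g unfolding L_moving_def by (meson finite_imageI)
  have "(k ` g ` f ` inv k ` A) \<bottom>\<^bsub>X\<^esub> (k ` f ` inv k ` A)"
    using invariance[OF _ _ _ k f(2)] fin k by simp
  then show "\<exists>f\<in>Fix X. (conj_by k g ` f ` A) \<bottom>\<^bsub>X\<^esub> (f ` A)"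
    using k conj_by_stabiliser[OF k f(1)] by (metis conj_by_image conj_by_conj_by_image)
qed

section \<open>Prescribing a product of four conjugates on a finite set\<close>

text \<open>Some \<open>f\<close> places \<open>A\<close> so that \<open>e\<close> moves it
  independently over \<open>X \<union> Y\<close>; pulling back by \<open>f\<close> gives a set
  \<open>B\<close> independent from \<open>A\<close> over \<open>X \<union> Y\<close>. Once
  \<open>B\<close> is moved over \<open>X \<union> Y \<union> A\<close> away from \<open>C\<close>,
  transitivity removes from the base first \<open>A\<close> and then, by \<open>ind\<close>, also
  \<open>X\<close>.\<close>

lemma conjugate_image_independent:
  assumes e: "L_moving e" and fin: "finite X" "finite Y" "finite C" "finite A"
    and ind: "X \<bottom>\<^bsub>Y\<^esub> C"
  obtains a where "a \<in> Fix (X \<union> Y)" "(conj_by a e ` A) \<bottom>\<^bsub>Y\<^esub> C"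
proof -
  have eG: "e \<in> Aut rel" using e by (simp add: L_moving_def)
  obtain f where f: "f \<in> Fix (X \<union> Y)" "(e ` f ` A) \<bottom>\<^bsub>X \<union> Y\<^esub> (f ` A)"
    using e fin unfolding L_moving_def by (meson finite_UnI)
  have fG: "f \<in> Aut rel" using f(1) by (rule stabiliser_Aut)
  define B where "B = inv f ` e ` f ` A"
  have finB: "finite B" using fin by (simp add: B_def)
  have "(inv f ` e ` f ` A) \<bottom>\<^bsub>inv f ` (X \<union> Y)\<^esub> (inv f ` f ` A)"
    using fin fG f(2) by (intro invariance) simp_all
  then have BA: "B \<bottom>\<^bsub>X \<union> Y\<^esub> A"
    using stabiliser_image[OF stabiliser_inv[OF f(1)] order_refl] fG by (simp add: B_def)
  obtain b where b: "b \<in> Fix (X \<union> Y \<union> A)" "(b ` B) \<bottom>\<^bsub>X \<union> Y \<union> A\<^esub> C"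
    using existence[OF finB, of "X \<union> Y \<union> A" C] fin by auto
  have bG: "b \<in> Aut rel" using b(1) by (rule stabiliser_Aut)
  have "(b ` B) \<bottom>\<^bsub>b ` (X \<union> Y)\<^esub> (b ` A)"
    using fin finB bG BA by (intro invariance) simp_all
  moreover have "b ` (X \<union> Y) = X \<union> Y" "b ` A = A"
    using b(1) by (auto intro!: stabiliser_image)
  ultimately have "(b ` B) \<bottom>\<^bsub>X \<union> Y\<^esub> A" by simp
  then have "(b ` B) \<bottom>\<^bsub>X \<union> Y\<^esub> C"
    using transitivity_right[of "b ` B" "X \<union> Y" A C] b(2) fin finB by simp
  then have "(b ` B) \<bottom>\<^bsub>Y\<^esub> C"
    using transitivity_left[of X Y C "b ` B"] ind fin finB by simp
  moreover have "conj_by (b \<circ> inv f) e ` A = b ` B"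
  proof -
    have "inv b ` A = A"
      using b(1) by (intro stabiliser_image[OF stabiliser_inv]) auto
    moreover have "inv (b \<circ> inv f) = f \<circ> inv b"
      using bG fG by (simp add: Aut_bij bij_imp_bij_inv o_inv_distrib)
    ultimately show ?thesis
      using conj_by_image[of "b \<circ> inv f" e A] bG fG
      by (simp add: B_def del: o_apply flip: image_comp)
  qed
  moreover have "b \<circ> inv f \<in> Fix (X \<union> Y)"
    using b(1) f(1) stabiliser_mono[of "X \<union> Y" "X \<union> Y \<union> A"] by (intro stabiliser_comp) auto
  ultimately show thesis by (metis that)
qed

text \<open>It suffices to find a copy \<open>Z\<close> of \<open>A\<close> such that
  \<open>Z\<close> and its image under \<open>e\<close> have the joint type over
  \<open>X \<union> Y\<close> of \<open>A\<close> and its image under \<open>u\<close>. Stationarity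
  gives this in three stages: for \<open>Z\<close>, for its image, and for the pair.\<close>

lemma conjugate_prescribed:
  assumes e: "R_moving e" and u: "u \<in> Aut rel" and fin: "finite X" "finite A"
    and Y: "Y = e ` X" and ue: "\<And>x. x \<in> X \<Longrightarrow> u x = e x"
    and AY: "A \<bottom>\<^bsub>X\<^esub> Y" and uX: "(u ` A) \<bottom>\<^bsub>Y\<^esub> X" and Au: "A \<bottom>\<^bsub>X \<union> Y\<^esub> (u ` A)"
  obtains a where "a \<in> Fix (X \<union> Y)" "\<And>x. x \<in> A \<Longrightarrow> conj_by a e x = u x"
proof -
  have eG: "e \<in> Aut rel" using e by (simp add: R_moving_def)
  \<comment> \<open>Adding \<open>D\<close> to the base controls the type over \<open>X\<close> of the image under \<open>e\<close>, since \<open>e ` D = X\<close>.\<close>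
  define D where "D = inv e ` X"
  have finYD: "finite Y" "finite D" using fin by (simp_all add: Y D_def)
  have eD: "e ` D = X" using eG by (simp add: D_def)
  obtain p where p: "p \<in> Fix X" "(p ` A) \<bottom>\<^bsub>X\<^esub> (Y \<union> D)"
    using existence[of A X "Y \<union> D"] fin finYD by auto
  obtain q where q: "q \<in> Fix (X \<union> Y \<union> D)" "(q ` p ` A) \<bottom>\<^bsub>X \<union> Y \<union> D\<^esub> (e ` q ` p ` A)"
    using e fin finYD unfolding R_moving_def by (meson finite_UnI finite_imageI)
  define r where "r = q \<circ> p"
  define Z where "Z = r ` A"
  have r: "r \<in> Fix X"
    unfolding r_def using p(1) q(1) stabiliser_mono[of X "X \<union> Y \<union> D"]
    by (intro stabiliser_comp) auto
  have rG: "r \<in> Aut rel" using r by (rule stabiliser_Aut)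
  have finZ: "finite Z" using fin by (simp add: Z_def)
  have ZeZ: "Z \<bottom>\<^bsub>X \<union> Y \<union> D\<^esub> (e ` Z)" using q(2) by (simp add: Z_def r_def image_comp comp_assoc)
  have "(q ` p ` A) \<bottom>\<^bsub>q ` X\<^esub> (q ` (Y \<union> D))"
    using p(2) fin finYD stabiliser_Aut[OF q(1)] by (intro invariance) simp_all
  moreover have "q ` X = X" "q ` (Y \<union> D) = Y \<union> D"
    using q(1) by (auto intro!: stabiliser_image)
  ultimately have ZYD: "Z \<bottom>\<^bsub>X\<^esub> (Y \<union> D)" by (simp add: Z_def r_def image_comp comp_assoc)
  have "Z \<bottom>\<^bsub>X \<union> Y\<^esub> D" using ZYD fin finYD finZ by (intro indep_mono[of _ _ "Y \<union> D"]) auto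
  then have ZeZ': "Z \<bottom>\<^bsub>X \<union> Y\<^esub> (e ` Z)"
    using transitivity_right[of Z "X \<union> Y" D "e ` Z"] ZeZ fin finYD finZ by simp
  have ZY: "(r ` A) \<bottom>\<^bsub>X\<^esub> Y"
    using indep_mono_right[OF _ _ _ ZYD] fin finYD finZ by (simp add: Z_def)
  obtain r' where r': "r' \<in> Fix (X \<union> Y)" "\<And>x. x \<in> A \<Longrightarrow> r' x = r x"
    using stationarity[OF fin(2,1) finYD(1) r AY ZY] by blast
  have "(e ` Z) \<bottom>\<^bsub>Y\<^esub> (e ` (Y \<union> D))"
    unfolding Y by (intro invariance) (use ZYD fin finYD finZ eG Y in simp_all)
  then have eZX: "(e ` Z) \<bottom>\<^bsub>Y\<^esub> X"
    by (rule indep_mono_right[rotated 3]) (use fin finYD finZ eD in auto)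
  \<comment> \<open>\<open>v\<close> takes the image of \<open>A\<close> under \<open>u\<close> to
    the image of \<open>Z\<close> under \<open>e\<close>. It fixes \<open>Y\<close> since
    \<open>u\<close> and \<open>e\<close> agree on \<open>X\<close>, which \<open>r\<close> fixes;
    stationarity replaces it by \<open>s\<close>, which fixes \<open>X\<close> as well.\<close>
  define v where "v = e \<circ> r \<circ> inv u"
  have iu: "inv u (e x) = x" if "x \<in> X" for x
    using Aut_inv_left[OF u, of x] ue[OF that] by simp
  have v: "v \<in> Fix Y"
    using eG rG u r by (auto simp: stabiliser_iff v_def Y iu)
  have vu: "v (u x) = e (r x)" for x using u by (simp add: v_def)
  have vX: "(v ` u ` A) \<bottom>\<^bsub>Y\<^esub> X"
    using eZX by (simp add: image_image vu Z_def)
  obtain s where s: "s \<in> Fix (Y \<union> X)" "\<And>y. y \<in> u ` A \<Longrightarrow> s y = v y"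
    using stationarity[OF _ finYD(1) fin(1) v uX vX] fin by blast
  have su: "s (u x) = e (r x)" if "x \<in> A" for x using s(2) vu that by simp
  have sXY: "s \<in> Fix (X \<union> Y)" using s(1) by (simp add: Un_commute)
  have sG: "s \<in> Aut rel" using s(1) by (rule stabiliser_Aut)
  have "s ` u ` A = e ` Z"
    unfolding Z_def image_image by (intro image_cong) (simp_all add: su)
  then have seZ: "inv s ` e ` Z = u ` A" using sG by (metis Aut_inv_image_left)
  have "(inv s ` Z) \<bottom>\<^bsub>inv s ` (X \<union> Y)\<^esub> (inv s ` e ` Z)"
    using ZeZ' fin finYD finZ sG by (intro invariance) simp_all
  then have sZ: "(inv s ` Z) \<bottom>\<^bsub>X \<union> Y\<^esub> (u ` A)"
    using stabiliser_image[OF stabiliser_inv[OF sXY] order_refl] seZ by simp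
  have "(inv s \<circ> r') ` A = inv s ` Z"
    by (force simp: Z_def image_image r'(2))
  with sZ have sZ': "((inv s \<circ> r') ` A) \<bottom>\<^bsub>X \<union> Y\<^esub> (u ` A)" by simp
  have sr': "inv s \<circ> r' \<in> Fix (X \<union> Y)" using sXY r'(1) by simp
  obtain t where t: "t \<in> Fix (X \<union> Y \<union> u ` A)" "\<And>x. x \<in> A \<Longrightarrow> t x = (inv s \<circ> r') x"
    using stationarity[OF fin(2) _ _ sr' Au sZ'] fin finYD by auto
  have tG: "t \<in> Aut rel" using t(1) by (rule stabiliser_Aut)
  have tXY: "t \<in> Fix (X \<union> Y)" using t(1) stabiliser_mono[of "X \<union> Y" "X \<union> Y \<union> u ` A"] by auto
  \<comment> \<open>\<open>s \<circ> t\<close> takes \<open>x\<close> to \<open>r x\<close> and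
    \<open>u x\<close> to \<open>e (r x)\<close> for \<open>x\<close> in \<open>A\<close>, so its
    inverse is the required conjugator.\<close>
  define a where "a = inv (s \<circ> t)"
  have "a \<in> Fix (X \<union> Y)" using sXY tXY by (simp add: a_def)
  moreover have "conj_by a e x = u x" if x: "x \<in> A" for x
  proof -
    have "t (u x) = u x" using t(1) x by (simp add: stabiliser_iff)
    then have "(s \<circ> t) (u x) = e (r x)" using su[OF x] by simp
    then have "a (e (r x)) = u x"
      unfolding a_def using sG tG by (metis Aut_comp Aut_inv_left)
    moreover have "inv a x = r x"
      using Aut_inv_inv[OF Aut_comp[OF sG tG]] sG t(2)[OF x] r'(2)[OF x] by (simp add: a_def)
    ultimately show ?thesis by (simp add: conj_by_apply)
  qed
  ultimately show thesis by (rule that)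
qed

text \<open>The outer conjugators come first, working forward from \<open>A\<close> and backward
  from its image under \<open>w\<close>. The inner maps then meet in a set \<open>A2\<close>
  independent over \<open>X2\<close> from all data, and \<open>conjugate_prescribed\<close> applies
  on both sides of it. The second map is treated through its inverse, because that lemma starts from
  the independent set.\<close>

lemma four_conjugates_prescribed:
  assumes e1: "L_moving e1" and e2: "R_moving (inv e2)" and e3: "R_moving e3"
    and e4: "L_moving (inv e4)" and e24: "e2 \<in> Aut rel" "e4 \<in> Aut rel"
    and fin: "finite X0" "finite A"
    and X: "X1 = e1 ` X0" "X2 = e2 ` X1" "X3 = e3 ` X2" "X4 = e4 ` X3"
    and ind: "X0 \<bottom>\<^bsub>X1\<^esub> X2" "X4 \<bottom>\<^bsub>X3\<^esub> X2"
    and w: "w \<in> Aut rel" "\<And>x. x \<in> X0 \<Longrightarrow> w x = e4 (e3 (e2 (e1 x)))"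
  obtains a1 a2 a3 a4
  where "a1 \<in> Fix (X0 \<union> X1)" "a2 \<in> Fix (X1 \<union> X2)" "a3 \<in> Fix (X2 \<union> X3)" "a4 \<in> Fix (X3 \<union> X4)"
    "\<And>x. x \<in> A \<Longrightarrow> conj_by a4 e4 (conj_by a3 e3 (conj_by a2 e2 (conj_by a1 e1 x))) = w x"
proof -
  have eG: "e1 \<in> Aut rel" "e3 \<in> Aut rel" using e1 e3 by (simp_all add: L_moving_def R_moving_def)
  note G = eG e24
  have finX: "finite X1" "finite X2" "finite X3" "finite X4" using fin by (simp_all add: X)
  obtain a1 where a1: "a1 \<in> Fix (X0 \<union> X1)" "(conj_by a1 e1 ` A) \<bottom>\<^bsub>X1\<^esub> X2"
    using conjugate_image_independent[OF e1 fin(1) finX(1,2) fin(2) ind(1)] by blast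
  obtain a4 where a4: "a4 \<in> Fix (X4 \<union> X3)" "(conj_by a4 (inv e4) ` w ` A) \<bottom>\<^bsub>X3\<^esub> X2"
    using conjugate_image_independent[OF e4 finX(4,3,2) _ ind(2)] fin by blast
  have aG: "a1 \<in> Aut rel" "a4 \<in> Aut rel" using a1(1) a4(1) stabiliser_Aut by blast+
  define E1 where "E1 = conj_by a1 e1"
  define E4 where "E4 = conj_by a4 e4"
  have EG: "E1 \<in> Aut rel" "E4 \<in> Aut rel" using aG G by (simp_all add: E1_def E4_def)
  have iE4: "conj_by a4 (inv e4) = inv E4" using conj_by_inv aG G by (simp add: E4_def)
  define A1 where "A1 = E1 ` A"
  define A3 where "A3 = inv E4 ` w ` A"
  have finA: "finite A1" "finite A3" using fin by (simp_all add: A1_def A3_def)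
  \<comment> \<open>The values left for the inner two maps to realise. On \<open>X1\<close> they
    agree with those of \<open>e3 \<circ> e2\<close>, since the outer conjugations keep
    \<open>e1\<close> on \<open>X0\<close> and \<open>e4\<close> on \<open>X3\<close>.\<close>
  define v where "v = inv E4 \<circ> w \<circ> inv E1"
  have vG: "v \<in> Aut rel" using EG w by (simp add: v_def)
  have vA1: "v ` A1 = A3" using EG by (simp add: v_def A1_def A3_def image_image)
  have E1X: "E1 x = e1 x" if "x \<in> X0" for x
    unfolding E1_def using that by (intro conj_by_stable[OF a1(1)]) (simp_all add: X)
  have E4X: "E4 x = e4 x" if "x \<in> X3" for x
    unfolding E4_def using that by (intro conj_by_stable[OF a4(1)]) (simp_all add: X)
  have vX: "v y = e3 (e2 y)" if y: "y \<in> X1" for y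
  proof -
    obtain x where x: "x \<in> X0" "y = e1 x" using y X(1) by auto
    then have "inv E1 y = x" using E1X EG by (metis Aut_inv_left)
    moreover have "w x = E4 (e3 (e2 y))" using w(2)[OF x(1)] x y E4X by (simp add: X)
    ultimately show ?thesis using EG by (simp add: v_def)
  qed
  define C where "C = X1 \<union> X3 \<union> A1 \<union> A3"
  have finC: "finite C" using finX finA by (simp add: C_def)
  \<comment> \<open>Since \<open>f\<close> fixes \<open>X2\<close>, \<open>f \<circ> e2\<close>
    agrees with \<open>e2\<close> on \<open>X1\<close>, while it sends \<open>A1\<close> to the
    meeting place \<open>A2\<close>.\<close>
  obtain f where f: "f \<in> Fix X2" "(f ` e2 ` A1) \<bottom>\<^bsub>X2\<^esub> C"
    using existence[of "e2 ` A1" X2 C] finA finX finC by auto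
  define m where "m = f \<circ> e2"
  have mG: "m \<in> Aut rel" using stabiliser_Aut[OF f(1)] G by (simp add: m_def)
  have mX: "m y = e2 y" if "y \<in> X1" for y
    using that f(1) by (simp add: m_def stabiliser_iff X(2))
  define A2 where "A2 = m ` A1"
  have finA2: "finite A2" using finA by (simp add: A2_def)
  have A2C: "A2 \<bottom>\<^bsub>X2\<^esub> C" using f(2) by (simp add: A2_def m_def image_comp)
  have imX: "inv m x = inv e2 x" if x: "x \<in> X2" for x
  proof -
    obtain y where "y \<in> X1" "x = e2 y" using x X(2) by auto
    then show ?thesis using mX mG G by (metis Aut_inv_left)
  qed
  have imA2: "inv m ` A2 = A1" using mG by (simp add: A2_def)
  obtain a2 where a2: "a2 \<in> Fix (X2 \<union> X1)" "\<And>x. x \<in> A2 \<Longrightarrow> conj_by a2 (inv e2) x = inv m x"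
  proof (rule conjugate_prescribed[OF e2 Aut_inv[OF mG] finX(2) finA2])
    show "X1 = inv e2 ` X2" using G by (simp add: X)
    show "A2 \<bottom>\<^bsub>X2\<^esub> X1"
      by (rule indep_mono_right[OF finA2 finX(2) finC A2C]) (auto simp: C_def)
    show "(inv m ` A2) \<bottom>\<^bsub>X1\<^esub> X2" using a1(2) by (simp add: imA2 A1_def E1_def)
    show "A2 \<bottom>\<^bsub>X2 \<union> X1\<^esub> (inv m ` A2)"
      unfolding imA2 by (rule indep_mono[OF finA2 finX(2) finC A2C]) (auto simp: C_def)
  qed (simp_all add: imX)
  have vmA2: "(v \<circ> inv m) ` A2 = A3" using imA2 vA1 by (simp only: flip: image_comp)
  obtain a3 where a3: "a3 \<in> Fix (X2 \<union> X3)" "\<And>x. x \<in> A2 \<Longrightarrow> conj_by a3 e3 x = (v \<circ> inv m) x"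
  proof (rule conjugate_prescribed[OF e3 _ finX(2) finA2])
    show "v \<circ> inv m \<in> Aut rel" using vG mG by simp
    show "A2 \<bottom>\<^bsub>X2\<^esub> X3"
      by (rule indep_mono_right[OF finA2 finX(2) finC A2C]) (auto simp: C_def)
    show "((v \<circ> inv m) ` A2) \<bottom>\<^bsub>X3\<^esub> X2" unfolding vmA2 using a4(2) by (simp add: A3_def iE4)
    show "A2 \<bottom>\<^bsub>X2 \<union> X3\<^esub> ((v \<circ> inv m) ` A2)"
      unfolding vmA2 by (rule indep_mono[OF finA2 finX(2) finC A2C]) (auto simp: C_def)
    show "(v \<circ> inv m) x = e3 x" if "x \<in> X2" for x
    proof -
      have "inv e2 x \<in> X1" using that G by (auto simp: X)
      then show ?thesis using that vX G by (simp add: imX)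
    qed
  qed (simp_all add: X)
  have a2G: "a2 \<in> Aut rel" using a2(1) by (rule stabiliser_Aut)
  have E2: "conj_by a2 e2 y = m y" if "y \<in> A1" for y
  proof -
    have "inv (conj_by a2 e2) (m y) = y"
      using a2(2)[of "m y"] that mG conj_by_inv[OF a2G G(3)] by (simp add: A2_def)
    then show ?thesis using conj_by_Aut[OF a2G G(3)] by (metis Aut_inv_right)
  qed
  show thesis
  proof (rule that)
    show "a1 \<in> Fix (X0 \<union> X1)" "a3 \<in> Fix (X2 \<union> X3)" by fact+
    show "a2 \<in> Fix (X1 \<union> X2)" "a4 \<in> Fix (X3 \<union> X4)" using a2(1) a4(1) by (simp_all add: Un_commute)
    fix x assume x: "x \<in> A"
    then have "E1 x \<in> A1" by (simp add: A1_def)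
    then have "conj_by a3 e3 (conj_by a2 e2 (E1 x)) = v (E1 x)"
      using E2 a3(2)[of "m (E1 x)"] mG by (simp add: A2_def)
    then show "conj_by a4 e4 (conj_by a3 e3 (conj_by a2 e2 (conj_by a1 e1 x))) = w x"
      using EG unfolding E1_def[symmetric] E4_def[symmetric] by (simp add: v_def)
  qed
qed

section \<open>Neighbourhoods of tuples, and the product map\<close>

text \<open>Tuples of four are functions on \<open>nat\<close> whose values at indices \<open>\<ge> 4\<close> are irrelevant.\<close>

definition tuples :: "(nat \<Rightarrow> 'a \<Rightarrow> 'a) set" where
  "tuples = {k. \<forall>i<4. k i \<in> Aut rel}"

text \<open>Basic neighbourhoods: a right coset of \<open>Fix F\<close> in each coordinate. Left
  factors are used because conjugating by \<open>a \<circ> k i\<close> means conjugating by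
  \<open>k i\<close> and then by \<open>a\<close>.\<close>

definition nbhd :: "(nat \<Rightarrow> 'a \<Rightarrow> 'a) \<Rightarrow> 'a set \<Rightarrow> (nat \<Rightarrow> 'a \<Rightarrow> 'a) set" where
  "nbhd k F = {k'. \<forall>i<4. \<exists>a\<in>Fix F. k' i = a \<circ> k i}"

lemma nbhd_tuples: "k \<in> tuples \<Longrightarrow> k' \<in> nbhd k F \<Longrightarrow> k' \<in> tuples"
  by (auto simp: tuples_def nbhd_def) (metis Aut_comp stabiliser_Aut)

lemma nbhd_self: "k \<in> nbhd k F"
  by (auto simp: nbhd_def intro!: bexI[of _ id])

lemma nbhd_trans:
  assumes "k' \<in> nbhd k F" "k'' \<in> nbhd k' F'" "F \<subseteq> F'"
  shows "k'' \<in> nbhd k F"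
  unfolding nbhd_def
proof (intro CollectI allI impI)
  fix i :: nat assume "i < 4"
  with assms obtain a b where ab: "a \<in> Fix F" "k' i = a \<circ> k i" "b \<in> Fix F'" "k'' i = b \<circ> k' i"
    unfolding nbhd_def by blast
  then have "b \<circ> a \<in> Fix F"
    using stabiliser_mono[OF assms(3)] by (intro stabiliser_comp) auto
  then show "\<exists>c\<in>Fix F. k'' i = c \<circ> k i" using ab by (auto simp: comp_assoc intro!: bexI[of _ "b \<circ> a"])
qed

lemma nbhd_sym:
  assumes "k' \<in> nbhd k F"
  shows "k \<in> nbhd k' F"
  unfolding nbhd_def
proof (intro CollectI allI impI)
  fix i :: nat assume "i < 4"
  with assms obtain a where a: "a \<in> Fix F" "k' i = a \<circ> k i"
    unfolding nbhd_def by blast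
  then have "k i = inv a \<circ> k' i"
    using stabiliser_Aut[OF a(1)] by (simp add: fun_eq_iff)
  then show "\<exists>c\<in>Fix F. k i = c \<circ> k' i" using a(1) stabiliser_inv by blast
qed

lemma nbhd_list:
  assumes "c0 \<in> Fix F" "c1 \<in> Fix F" "c2 \<in> Fix F" "c3 \<in> Fix F"
  shows "(\<lambda>i. ([c0, c1, c2, c3] ! i) \<circ> k i) \<in> nbhd k F"
  unfolding nbhd_def
proof (intro CollectI allI impI)
  fix i :: nat assume "i < 4"
  then have "[c0, c1, c2, c3] ! i \<in> set [c0, c1, c2, c3]" by (intro nth_mem) simp
  then have "[c0, c1, c2, c3] ! i \<in> Fix F" using assms by auto
  then show "\<exists>a\<in>Fix F. ([c0, c1, c2, c3] ! i) \<circ> k i = a \<circ> k i" by blast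
qed

text \<open>The factor \<open>h\<close> lets one map serve both sides of the final equation:
  \<open>id\<close> with \<open>g\<close>, and the given element with \<open>inv g\<close>.\<close>

definition conj_product :: "('a \<Rightarrow> 'a) \<Rightarrow> ('a \<Rightarrow> 'a) \<Rightarrow> (nat \<Rightarrow> 'a \<Rightarrow> 'a) \<Rightarrow> 'a \<Rightarrow> 'a" where
  "conj_product h g k =
     h \<circ> conj_by (k 3) g \<circ> conj_by (k 2) g \<circ> conj_by (k 1) g \<circ> conj_by (k 0) g"

text \<open>Density of the image of \<open>U\<close> in a basic open set of the group; with
  \<open>X\<close> empty this set is the whole group.\<close>

definition dense_near ::
    "((nat \<Rightarrow> 'a \<Rightarrow> 'a) \<Rightarrow> 'a \<Rightarrow> 'a) \<Rightarrow> (nat \<Rightarrow> 'a \<Rightarrow> 'a) set \<Rightarrow> ('a \<Rightarrow> 'a) \<Rightarrow> 'a set \<Rightarrow> bool" where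
  "dense_near \<phi> U w X \<longleftrightarrow>
     (\<forall>v\<in>Aut rel. (\<forall>x\<in>X. v x = w x) \<longrightarrow>
        (\<forall>D. finite D \<longrightarrow> (\<exists>k\<in>U. \<forall>x\<in>D. \<phi> k x = v x)))"

lemma dense_near_mono:
  assumes "dense_near \<phi> U w X" "\<forall>x\<in>X. w' x = w x" "X \<subseteq> X'" "U \<subseteq> U'"
  shows "dense_near \<phi> U' w' X'"
  using assms unfolding dense_near_def by (metis subsetD)

text \<open>Besides continuity this is a weak openness. The open set is centred at a value taken in
  the neighbourhood itself, so the choice of \<open>k'\<close> also supplies the next
  target.\<close>

definition nearly_open :: "((nat \<Rightarrow> 'a \<Rightarrow> 'a) \<Rightarrow> 'a \<Rightarrow> 'a) \<Rightarrow> bool" where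
  "nearly_open \<phi> \<longleftrightarrow>
     (\<forall>k\<in>tuples. \<phi> k \<in> Aut rel) \<and>
     (\<forall>k\<in>tuples. \<forall>D. finite D \<longrightarrow>
        (\<exists>F. finite F \<and> (\<forall>k'\<in>nbhd k F. \<forall>x\<in>D. \<phi> k' x = \<phi> k x))) \<and>
     (\<forall>k\<in>tuples. \<forall>F. finite F \<longrightarrow>
        (\<exists>k'\<in>nbhd k F. \<exists>X. finite X \<and> dense_near \<phi> (nbhd k F) (\<phi> k') X))"

lemma nearly_open_Aut: "nearly_open \<phi> \<Longrightarrow> k \<in> tuples \<Longrightarrow> \<phi> k \<in> Aut rel"
  by (simp add: nearly_open_def)

lemma nearly_open_continuous:
  assumes "nearly_open \<phi>" "k \<in> tuples" "finite D"
  obtains F where "finite F" "\<And>k' x. k' \<in> nbhd k F \<Longrightarrow> x \<in> D \<Longrightarrow> \<phi> k' x = \<phi> k x"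
  using assms unfolding nearly_open_def by metis

lemma nearly_open_dense:
  assumes "nearly_open \<phi>" "k \<in> tuples" "finite F"
  obtains k' X where "k' \<in> nbhd k F" "finite X" "dense_near \<phi> (nbhd k F) (\<phi> k') X"
  using assms unfolding nearly_open_def by metis

text \<open>\<open>F\<close> collects the points met by \<open>D\<close> on its way through the four
  factors; conjugating a factor by a map fixing \<open>F\<close> keeps its values there.\<close>

lemma conj_product_continuous:
  assumes "k \<in> tuples" "finite D"
  shows "\<exists>F. finite F \<and> (\<forall>k'\<in>nbhd k F. \<forall>x\<in>D. conj_product h g k' x = conj_product h g k x)"
proof -
  define E where "E i = conj_by (k i) g" for i
  define D1 where "D1 = E 0 ` D"
  define D2 where "D2 = E 1 ` D1"
  define D3 where "D3 = E 2 ` D2"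
  define F where "F = D \<union> D1 \<union> D2 \<union> D3 \<union> E 3 ` D3"
  have eq: "conj_by (k' i) g x = E i x"
    if k': "k' \<in> nbhd k F" and i: "i < 4" and x: "x \<in> F" "E i x \<in> F" for k' i x
  proof -
    obtain a where a: "a \<in> Fix F" "k' i = a \<circ> k i" using k' i unfolding nbhd_def by blast
    have "conj_by (k' i) g = conj_by a (E i)"
      using a(2) conj_by_comp[OF stabiliser_Aut[OF a(1)]] i assms(1) by (simp add: tuples_def E_def)
    then show ?thesis using conj_by_stable[of a rel F x "E i"] a(1) x by simp
  qed
  have "conj_product h g k' x = conj_product h g k x" if k': "k' \<in> nbhd k F" and x: "x \<in> D" for k' x
  proof -
    have "x \<in> F" "E 0 x \<in> F" "E 1 (E 0 x) \<in> F" "E 2 (E 1 (E 0 x)) \<in> F" "E 3 (E 2 (E 1 (E 0 x))) \<in> F"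
      using x by (auto simp: F_def D1_def D2_def D3_def)
    then have "conj_product h g k' x = h (E 3 (E 2 (E 1 (E 0 x))))"
      by (simp add: conj_product_def eq[OF k'])
    then show ?thesis by (simp add: conj_product_def E_def)
  qed
  moreover have "finite F" using assms(2) by (simp add: F_def D1_def D2_def D3_def)
  ultimately show ?thesis by blast
qed

lemma conj_product_Aut: "h \<in> Aut rel \<Longrightarrow> g \<in> Aut rel \<Longrightarrow> k \<in> tuples \<Longrightarrow> conj_product h g k \<in> Aut rel"
  by (simp add: conj_product_def tuples_def)

text \<open>
  The independence hypotheses of \<open>four_conjugates_prescribed\<close> are reached by first enlarging
  \<open>X\<^sub>1\<close> and \<open>X\<^sub>3\<close> so that they contain everything to be fixed, and then conjugating the outer two
  maps over \<open>X\<^sub>1\<close> and \<open>X\<^sub>3\<close> to move \<open>X\<^sub>0\<close> and \<open>X\<^sub>4\<close> away from \<open>X\<^sub>2\<close>.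
\<close>

lemma conj_product_dense_near:
  assumes h: "h \<in> Aut rel" and k: "k \<in> tuples" and F: "finite F"
    and g: "R_moving g" "L_moving g" "R_moving (inv g)" "L_moving (inv g)"
  obtains k' X where "k' \<in> nbhd k F" "finite X" "F = {} \<Longrightarrow> X = {}"
    "dense_near (conj_product h g) (nbhd k F) (conj_product h g k') X"
proof -
  have gG: "g \<in> Aut rel" using g by (simp add: R_moving_def)
  have kG: "k 0 \<in> Aut rel" "k 1 \<in> Aut rel" "k 2 \<in> Aut rel" "k 3 \<in> Aut rel"
    using k by (simp_all add: tuples_def)
  define E where "E i = conj_by (k i) g" for i
  have EG: "E 0 \<in> Aut rel" "E 1 \<in> Aut rel" "E 2 \<in> Aut rel" "E 3 \<in> Aut rel"
    unfolding E_def using kG gG by (simp_all only: conj_by_Aut)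
  \<comment> \<open>The second set in the union ensures that \<open>X3\<close> contains
    \<open>F\<close> too, so that conjugators fixing \<open>X1\<close> or \<open>X3\<close> stay in
    the neighbourhood.\<close>
  define X1 where "X1 = F \<union> inv (E 1) ` inv (E 2) ` F"
  define X2 where "X2 = E 1 ` X1"
  define X3 where "X3 = E 2 ` X2"
  have finX: "finite X1" "finite X2" "finite X3" using F by (simp_all add: X1_def X2_def X3_def)
  have F1: "F \<subseteq> X1" by (simp add: X1_def)
  have "E 2 ` E 1 ` inv (E 1) ` inv (E 2) ` F = F" using EG by simp
  then have F3: "F \<subseteq> X3" unfolding X3_def X2_def X1_def image_Un by blast
  \<comment> \<open>After conjugation the first map still ends in \<open>X1\<close> and the last
    still starts in \<open>X3\<close>; only their far ends move away from \<open>X2\<close>.\<close>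
  obtain a0 where a0: "a0 \<in> Fix X1" "(a0 ` inv (E 0) ` X1) \<bottom>\<^bsub>X1\<^esub> X2"
    using existence[OF _ finX(1,2)] finX(1) by (metis finite_imageI)
  obtain a3 where a3: "a3 \<in> Fix X3" "(a3 ` E 3 ` X3) \<bottom>\<^bsub>X3\<^esub> X2"
    using existence[OF _ finX(3,2)] finX(3) by (metis finite_imageI)
  have aG: "a0 \<in> Aut rel" "a3 \<in> Aut rel" using a0(1) a3(1) stabiliser_Aut by blast+
  have aF: "a0 \<in> Fix F" "a3 \<in> Fix F" using a0(1) a3(1) stabiliser_mono F1 F3 by blast+
  define X0 where "X0 = a0 ` inv (E 0) ` X1"
  define k' where "k' = (\<lambda>i. ([a0, id, id, a3] ! i) \<circ> k i)"
  have k': "k' \<in> nbhd k F" unfolding k'_def using aF by (intro nbhd_list) simp_all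
  define E0 where "E0 = conj_by a0 (E 0)"
  define E3 where "E3 = conj_by a3 (E 3)"
  have E0': "E0 = conj_by (a0 \<circ> k 0) g" "E3 = conj_by (a3 \<circ> k 3) g"
    using aG kG by (simp_all add: E0_def E3_def E_def conj_by_comp)
  have mov: "L_moving E0" "R_moving (inv (E 1))" "R_moving (E 2)" "L_moving (inv E3)" "E3 \<in> Aut rel"
    using g aG kG gG L_moving_conj[OF g(2), of "a0 \<circ> k 0"] R_moving_conj[OF g(3), of "k 1"]
      R_moving_conj[OF g(1), of "k 2"] L_moving_conj[OF g(4), of "a3 \<circ> k 3"]
    unfolding E0' E_def by (simp_all add: conj_by_inv[of _ rel])
  have X1: "X1 = E0 ` X0"
    using aG EG stabiliser_image[OF a0(1) order_refl] by (simp add: E0_def X0_def conj_by_image)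
  have X4: "a3 ` E 3 ` X3 = E3 ` X3"
    using aG stabiliser_image[OF stabiliser_inv[OF a3(1)] order_refl] by (simp add: E3_def conj_by_image)
  have finX0: "finite X0" using finX by (simp add: X0_def)
  have prod: "conj_product h g k' x = h (E3 (E 2 (E 1 (E0 x))))" for x
    by (simp add: conj_product_def k'_def E0' E_def)
  show thesis
  proof (rule that[OF k' finX0])
    show "X0 = {}" if "F = {}" using that by (simp add: X0_def X1_def)
    show "dense_near (conj_product h g) (nbhd k F) (conj_product h g k') X0"
      unfolding dense_near_def
    proof (intro ballI impI allI)
      fix v D assume v: "v \<in> Aut rel" "\<forall>x\<in>X0. v x = conj_product h g k' x" and D: "finite (D :: 'a set)"
      have w: "inv h \<circ> v \<in> Aut rel" "\<And>x. x \<in> X0 \<Longrightarrow> (inv h \<circ> v) x = E3 (E 2 (E 1 (E0 x)))"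
        using h v by (simp_all add: prod)
      obtain b0 b1 b2 b3
        where b: "b0 \<in> Fix (X0 \<union> X1)" "b1 \<in> Fix (X1 \<union> X2)" "b2 \<in> Fix (X2 \<union> X3)"
          "b3 \<in> Fix (X3 \<union> E3 ` X3)"
          and eq: "\<And>x. x \<in> D \<Longrightarrow>
            conj_by b3 E3 (conj_by b2 (E 2) (conj_by b1 (E 1) (conj_by b0 E0 x))) = (inv h \<circ> v) x"
        using four_conjugates_prescribed[OF mov(1-4) EG(2) mov(5) finX0 D X1 X2_def X3_def refl
            _ _ w] a0(2) a3(2) X0_def X4 by metis
      have bF: "b0 \<in> Fix F" "b1 \<in> Fix F" "b2 \<in> Fix F" "b3 \<in> Fix F"
        using b stabiliser_mono F1 F3 by (meson le_supI1 le_supI2 subsetD)+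
      note bG = bF[THEN stabiliser_Aut]
      define k'' where "k'' = (\<lambda>i. ([b0 \<circ> a0, b1, b2, b3 \<circ> a3] ! i) \<circ> k i)"
      have "k'' \<in> nbhd k F"
        unfolding k''_def using aF bF by (intro nbhd_list) simp_all
      moreover have "conj_product h g k'' x = v x" if x: "x \<in> D" for x
      proof -
        have "conj_by (b0 \<circ> a0 \<circ> k 0) g = conj_by b0 E0" "conj_by (b1 \<circ> k 1) g = conj_by b1 (E 1)"
          "conj_by (b2 \<circ> k 2) g = conj_by b2 (E 2)" "conj_by (b3 \<circ> a3 \<circ> k 3) g = conj_by b3 E3"
          using aG kG bG by (simp_all add: E0' E_def comp_assoc conj_by_comp[of _ rel])
        then have "conj_product h g k'' x =
            h (conj_by b3 E3 (conj_by b2 (E 2) (conj_by b1 (E 1) (conj_by b0 E0 x))))"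
          by (simp add: conj_product_def k''_def)
        then show ?thesis using eq[OF x] h by simp
      qed
      ultimately show "\<exists>k\<in>nbhd k F. \<forall>x\<in>D. conj_product h g k x = v x" by blast
    qed
  qed
qed

lemma conj_product_nearly_open:
  assumes "h \<in> Aut rel" "R_moving g" "L_moving g" "R_moving (inv g)" "L_moving (inv g)"
  shows "nearly_open (conj_product h g)"
  unfolding nearly_open_def
proof (intro conjI ballI allI impI)
  show "conj_product h g k \<in> Aut rel" if "k \<in> tuples" for k
    using that assms by (intro conj_product_Aut) (simp_all add: R_moving_def)
  show "\<exists>F. finite F \<and> (\<forall>k'\<in>nbhd k F. \<forall>x\<in>D. conj_product h g k' x = conj_product h g k x)"
    if "k \<in> tuples" "finite D" for k D
    using that by (rule conj_product_continuous)
  show "\<exists>k'\<in>nbhd k F. \<exists>X. finite X \<and> dense_near (conj_product h g) (nbhd k F) (conj_product h g k') X"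
    if "k \<in> tuples" "finite F" for k F
    using conj_product_dense_near[OF assms(1) that assms(2-5)] by metis
qed

text \<open>With \<open>F\<close> empty, \<open>conj_product_dense_near\<close> returns an empty set
  \<open>X\<close>, so no constraint on the target remains.\<close>

lemma conj_product_dense:
  assumes "h \<in> Aut rel" "R_moving g" "L_moving g" "R_moving (inv g)" "L_moving (inv g)"
  shows "dense_near (conj_product h g) (nbhd (\<lambda>_. id) {}) id {}"
proof -
  have "(\<lambda>_. id) \<in> tuples" by (simp add: tuples_def)
  from conj_product_dense_near[OF assms(1) this _ assms(2-5), of "{}"]
  obtain k' where "dense_near (conj_product h g) (nbhd (\<lambda>_. id) {}) (conj_product h g k') {}"
    by (metis finite.emptyI)
  then show ?thesis by (rule dense_near_mono) simp_all
qed

section \<open>Matching two nearly open maps\<close>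

text \<open>Once \<open>k n x\<close> lies in \<open>F n\<close>, all later maps agree at
  \<open>x\<close>, so a pointwise limit exists. Preimages of points of \<open>F n\<close> are
  frozen as well, which makes the limit surjective; a relation on a finite list is decided by some
  \<open>k m\<close>.\<close>

lemma Aut_limit:
  assumes k: "\<And>n. k n \<in> Aut rel" and F: "\<And>n. F n \<subseteq> F (Suc n)"
    and step: "\<And>n. \<exists>a\<in>Fix (F n). k (Suc n) = a \<circ> k n"
    and cover: "\<And>x. \<exists>n. x \<in> F n" "\<And>x. \<exists>n. k n x \<in> F n"
  obtains l where "\<And>n. \<exists>a\<in>Fix (F n). l = a \<circ> k n"
proof -
  have later: "\<exists>a\<in>Fix (F n). k m = a \<circ> k n" if "n \<le> m" for n m
    using that
  proof (induction m rule: dec_induct)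
    case base
    then show ?case by (auto intro!: bexI[of _ id])
  next
    case (step m)
    then obtain a where a: "a \<in> Fix (F n)" "k m = a \<circ> k n" by blast
    obtain b where b: "b \<in> Fix (F m)" "k (Suc m) = b \<circ> k m" using assms(3) by blast
    have "F n \<subseteq> F m" using step(1) F by (rule lift_Suc_mono_le[rotated])
    with b(1) have "b \<in> Fix (F n)" using stabiliser_mono by blast
    then show ?case using a b(2) by (auto simp: comp_assoc intro!: bexI[of _ "b \<circ> a"])
  qed
  have "\<exists>y n. \<forall>m\<ge>n. k m x = y" for x
  proof -
    obtain n where n: "k n x \<in> F n" using cover(2) by blast
    have "k m x = k n x" if "n \<le> m" for m
      using later[OF that] n by (auto simp: stabiliser_iff)
    then show ?thesis by blast
  qed
  then obtain l where "\<And>x. \<exists>n. \<forall>m\<ge>n. k m x = l x" by metis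
  then have l: "\<forall>\<^sub>F m in sequentially. k m x = l x" for x
    by (simp add: eventually_sequentially)
  have inv_eq: "l (inv (k n) y) = y" if y: "y \<in> F n" for n y
  proof -
    have "k m (inv (k n) y) = y" if "n \<le> m" for m
      using later[OF that] y k[of n] by (auto simp: stabiliser_iff)
    then have "\<forall>\<^sub>F m in sequentially. k m (inv (k n) y) = y"
      by (auto simp: eventually_sequentially)
    with l[of "inv (k n) y"] have "\<forall>\<^sub>F m in sequentially. l (inv (k n) y) = y"
      by eventually_elim simp
    then show ?thesis by simp
  qed
  have "inj l"
  proof (rule injI)
    fix x y assume xy: "l x = l y"
    from l[of x] l[of y] have "\<forall>\<^sub>F m in sequentially. x = y"
    proof eventually_elim
      case (elim m)
      then show ?case using xy k[of m] by (metis Aut_inv_left)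
    qed
    then show "x = y" by simp
  qed
  moreover have "\<exists>x. y = l x" for y
    using cover(1)[of y] inv_eq[of y] by (auto intro: sym)
  then have "surj l" unfolding surj_def by blast
  moreover have "rel r (map l xs) \<longleftrightarrow> rel r xs" for r xs
  proof -
    have "\<forall>\<^sub>F m in sequentially. \<forall>x\<in>set xs. k m x = l x"
      using l by (simp add: eventually_ball_finite)
    then have "\<forall>\<^sub>F m in sequentially. rel r (map l xs) \<longleftrightarrow> rel r xs"
    proof eventually_elim
      case (elim m)
      then have "map l xs = map (k m) xs" by simp
      then show ?case using k[of m] by (simp only: Aut_iff)
    qed
    then show ?thesis by simp
  qed
  ultimately have lG: "l \<in> Aut rel" by (simp add: Aut_iff bij_def)
  show thesis
  proof (rule that)
    fix n
    have "l \<circ> inv (k n) \<in> Fix (F n)"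
      using lG k[of n] inv_eq by (simp add: stabiliser_iff)
    moreover have "l = (l \<circ> inv (k n)) \<circ> k n" using k[of n] by (simp add: fun_eq_iff)
    ultimately show "\<exists>a\<in>Fix (F n). l = a \<circ> k n" by blast
  qed
qed

lemma tuples_limit:
  assumes k: "\<And>n. k n \<in> tuples" and F: "\<And>n. F n \<subseteq> F (Suc n)"
    and step: "\<And>n. k (Suc n) \<in> nbhd (k n) (F n)"
    and cover: "\<And>x. \<exists>n. x \<in> F n" "\<And>x. \<exists>n. \<forall>i<4. k n i x \<in> F n"
  obtains l where "\<And>n. l \<in> nbhd (k n) (F n)"
proof -
  have "\<exists>l. \<forall>n. \<exists>a\<in>Fix (F n). l = a \<circ> k n i" if i: "i < 4" for i
  proof (rule Aut_limit[of "\<lambda>n. k n i" F])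
    show "\<exists>a\<in>Fix (F n). k (Suc n) i = a \<circ> k n i" for n using step i unfolding nbhd_def by blast
    show "\<exists>n. k n i x \<in> F n" for x using cover(2) i by blast
  qed (use k F cover(1) i in \<open>auto simp: tuples_def\<close>)
  then obtain l where "\<forall>i<4. \<forall>n. \<exists>a\<in>Fix (F n). l i = a \<circ> k n i" by metis
  then show thesis by (intro that[of l]) (simp add: nbhd_def)
qed

text \<open>Half a round of the back-and-forth. Density gives \<open>k0\<close> with the values of
  \<open>w\<close> on \<open>X\<close>, continuity freezes them, and near openness shrinks the
  target to an open set around \<open>\<phi> k'\<close>. As this lies in the old one,
  \<open>\<psi>\<close> stays dense in it.\<close>

lemma nearly_open_refine:
  assumes \<phi>: "nearly_open \<phi>" and k: "k \<in> tuples" and fin: "finite F" "finite X"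
    and w: "w \<in> Aut rel" and dense: "dense_near \<phi> (nbhd k F) w X" "dense_near \<psi> V w X"
  obtains k' F' w' X' where "k' \<in> nbhd k F" "k' \<in> tuples" "insert d F \<subseteq> F'" "finite F'"
    "\<forall>i<4. k' i d \<in> F'" "insert d X \<subseteq> X'" "finite X'" "w' \<in> Aut rel" "\<forall>x\<in>X. w' x = w x"
    "dense_near \<phi> (nbhd k' F') w' X'" "dense_near \<psi> V w' X'"
    "\<forall>\<kappa>\<in>nbhd k' F'. \<forall>x\<in>X. \<phi> \<kappa> x = w x"
proof -
  obtain k0 where k0: "k0 \<in> nbhd k F" "\<forall>x\<in>X. \<phi> k0 x = w x"
    using dense(1) w fin(2) unfolding dense_near_def by blast
  have k0t: "k0 \<in> tuples" using nbhd_tuples[OF k k0(1)] .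
  obtain F0 where F0: "finite F0" "\<And>\<kappa> x. \<kappa> \<in> nbhd k0 F0 \<Longrightarrow> x \<in> X \<Longrightarrow> \<phi> \<kappa> x = \<phi> k0 x"
    using nearly_open_continuous[OF \<phi> k0t fin(2)] by metis
  \<comment> \<open>\<open>d\<close> and its images enter \<open>F'\<close> for the sake of the
    later limit; \<open>k'\<close> differs from \<open>k0\<close> by maps fixing \<open>F'\<close>
    and so has the same images of \<open>d\<close>.\<close>
  define F' where "F' = insert d (F \<union> F0 \<union> (\<lambda>i. k0 i d) ` {..<4})"
  have F': "finite F'" "F \<subseteq> F'" "F0 \<subseteq> F'" using fin F0(1) by (auto simp: F'_def)
  obtain k' X0 where k': "k' \<in> nbhd k0 F'" and X0: "finite X0"
    and dk': "dense_near \<phi> (nbhd k0 F') (\<phi> k') X0"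
    by (rule nearly_open_dense[OF \<phi> k0t F'(1)])
  have k't: "k' \<in> tuples" using nbhd_tuples[OF k0t k'] .
  have val: "\<phi> \<kappa> x = w x" if "\<kappa> \<in> nbhd k' F'" "x \<in> X" for \<kappa> x
  proof -
    have "\<kappa> \<in> nbhd k0 F0"
      using nbhd_trans[OF nbhd_self nbhd_trans[OF k' that(1) order_refl] F'(3)] .
    then show ?thesis using F0(2)[of \<kappa> x] k0(2) that(2) by simp
  qed
  show thesis
  proof (rule that)
    show "k' \<in> nbhd k F" using nbhd_trans[OF k0(1) k' F'(2)] .
    show "insert d F \<subseteq> F'" by (auto simp: F'_def)
    show "\<forall>i<4. k' i d \<in> F'"
    proof (intro allI impI)
      fix i :: nat assume i: "i < 4"
      then obtain a where "a \<in> Fix F'" "k' i = a \<circ> k0 i" using k' unfolding nbhd_def by blast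
      moreover have "k0 i d \<in> F'" using i by (simp add: F'_def)
      ultimately show "k' i d \<in> F'" by (simp add: stabiliser_iff)
    qed
    show "insert d X \<subseteq> insert d (X \<union> X0)" "finite (insert d (X \<union> X0))" using fin X0 by auto
    show "\<phi> k' \<in> Aut rel" using nearly_open_Aut[OF \<phi> k't] .
    show w': "\<forall>x\<in>X. \<phi> k' x = w x" using val[OF nbhd_self] by blast
    show "dense_near \<psi> V (\<phi> k') (insert d (X \<union> X0))"
      by (rule dense_near_mono[OF dense(2) w']) auto
    have "nbhd k0 F' \<subseteq> nbhd k' F'" using nbhd_trans[OF nbhd_sym[OF k']] by blast
    then show "dense_near \<phi> (nbhd k' F') (\<phi> k') (insert d (X \<union> X0))"
      by (intro dense_near_mono[OF dk']) auto
  qed (use k't F'(1) val in auto)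
qed

text \<open>Both maps take turns shrinking a common target in which both stay dense. In the limit
  both attain the values of \<open>w n\<close> on \<open>X n\<close>, and these sets exhaust the
  universe.\<close>

lemma nearly_open_common_value:
  fixes d :: "nat \<Rightarrow> 'a"
  assumes \<phi>: "nearly_open \<phi>" "dense_near \<phi> (nbhd (\<lambda>_. id) {}) id {}"
    and \<psi>: "nearly_open \<psi>" "dense_near \<psi> (nbhd (\<lambda>_. id) {}) id {}"
    and d: "surj d"
  shows "\<exists>k\<in>tuples. \<exists>l\<in>tuples. \<phi> k = \<psi> l"
proof -
  \<comment> \<open>A state consists of a neighbourhood for each map and the target given by
    \<open>w\<close> and \<open>X\<close>; \<open>Q\<close> relates the states before and after
    round \<open>n\<close>.\<close>
  define P where "P = (\<lambda>(k, F, l, E, w, X). k \<in> tuples \<and> l \<in> tuples \<and> finite F \<and> finite E \<and>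
    finite X \<and> w \<in> Aut rel \<and> dense_near \<phi> (nbhd k F) w X \<and> dense_near \<psi> (nbhd l E) w X)"
  define Q where "Q = (\<lambda>n (k, F, l, E, w, X) (k', F', l', E', w' :: 'a \<Rightarrow> 'a, X').
    k' \<in> nbhd k F \<and> l' \<in> nbhd l E \<and> insert (d n) F \<subseteq> F' \<and> insert (d n) E \<subseteq> E' \<and>
    (\<forall>i<4. k' i (d n) \<in> F') \<and> (\<forall>i<4. l' i (d n) \<in> E') \<and> d n \<in> X' \<and>
    (\<forall>\<kappa>\<in>nbhd k' F'. \<forall>x\<in>X. \<phi> \<kappa> x = w x) \<and> (\<forall>\<kappa>\<in>nbhd l' E'. \<forall>x\<in>X. \<psi> \<kappa> x = w x))"
  have ex: "\<exists>s. P s"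
    using \<phi>(2) \<psi>(2) by (intro exI[of _ "(\<lambda>_. id, {}, \<lambda>_. id, {}, id, {})"]) (simp add: P_def tuples_def)
  have step: "\<exists>s'. P s' \<and> Q n s s'" if "P s" for s n
  proof -
    obtain k F l E w X where s: "s = (k, F, l, E, w, X)" by (metis prod_cases6)
    have Ps: "k \<in> tuples" "l \<in> tuples" "finite F" "finite E" "finite X" "w \<in> Aut rel"
      "dense_near \<phi> (nbhd k F) w X" "dense_near \<psi> (nbhd l E) w X"
      using that by (simp_all add: P_def s)
    obtain k' F' w1 X1 where 1: "k' \<in> nbhd k F" "k' \<in> tuples" "insert (d n) F \<subseteq> F'" "finite F'"
      "\<forall>i<4. k' i (d n) \<in> F'" "insert (d n) X \<subseteq> X1" "finite X1" "w1 \<in> Aut rel" "\<forall>x\<in>X. w1 x = w x"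
      "dense_near \<phi> (nbhd k' F') w1 X1" "dense_near \<psi> (nbhd l E) w1 X1"
      "\<forall>\<kappa>\<in>nbhd k' F'. \<forall>x\<in>X. \<phi> \<kappa> x = w x"
      using nearly_open_refine[OF \<phi>(1) Ps(1,3,5,6,7,8)] by metis
    obtain l' E' w2 X2 where 2: "l' \<in> nbhd l E" "l' \<in> tuples" "insert (d n) E \<subseteq> E'" "finite E'"
      "\<forall>i<4. l' i (d n) \<in> E'" "insert (d n) X1 \<subseteq> X2" "finite X2" "w2 \<in> Aut rel" "\<forall>x\<in>X1. w2 x = w1 x"
      "dense_near \<psi> (nbhd l' E') w2 X2" "dense_near \<phi> (nbhd k' F') w2 X2"
      "\<forall>\<kappa>\<in>nbhd l' E'. \<forall>x\<in>X1. \<psi> \<kappa> x = w1 x"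
      using nearly_open_refine[OF \<psi>(1) Ps(2,4) 1(7,8,11,10)] by metis
    have "P (k', F', l', E', w2, X2)" using 1 2 by (simp add: P_def)
    moreover have "\<psi> \<kappa> x = w x" if "\<kappa> \<in> nbhd l' E'" "x \<in> X" for \<kappa> x
      using that 2(12) 1(6,9) by (metis insert_subset subsetD)
    then have "Q n s (k', F', l', E', w2, X2)" using 1 2 by (auto simp: Q_def s)
    ultimately show ?thesis by blast
  qed
  obtain s where s: "\<And>n. P (s n)" "\<And>n. Q n (s n) (s (Suc n))"
    using dependent_nat_choice[of "\<lambda>_. P" Q] ex step by metis
  define k F l E w X where "k n = fst (s n)" and "F n = fst (snd (s n))"
    and "l n = fst (snd (snd (s n)))" and "E n = fst (snd (snd (snd (s n))))"
    and "w n = fst (snd (snd (snd (snd (s n)))))" and "X n = snd (snd (snd (snd (snd (s n)))))" for n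
  note defs = k_def F_def l_def E_def w_def X_def
  have Pn: "k n \<in> tuples" "l n \<in> tuples" for n
    using s(1)[of n] by (simp_all add: P_def defs case_prod_beta)
  have Qn: "k (Suc n) \<in> nbhd (k n) (F n)" "l (Suc n) \<in> nbhd (l n) (E n)"
    "insert (d n) (F n) \<subseteq> F (Suc n)" "insert (d n) (E n) \<subseteq> E (Suc n)"
    "\<forall>i<4. k (Suc n) i (d n) \<in> F (Suc n)" "\<forall>i<4. l (Suc n) i (d n) \<in> E (Suc n)" "d n \<in> X (Suc n)"
    "\<forall>\<kappa>\<in>nbhd (k (Suc n)) (F (Suc n)). \<forall>x\<in>X n. \<phi> \<kappa> x = w n x"
    "\<forall>\<kappa>\<in>nbhd (l (Suc n)) (E (Suc n)). \<forall>x\<in>X n. \<psi> \<kappa> x = w n x" for n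
    using s(2)[of n] by (simp_all add: Q_def defs case_prod_beta)
  have dx: "\<exists>n. x = d n" for x using d by (metis surjD)
  obtain k' where k': "\<And>n. k' \<in> nbhd (k n) (F n)"
  proof (rule tuples_limit[of k F])
    show "\<exists>n. x \<in> F n" "\<exists>n. \<forall>i<4. k n i x \<in> F n" for x
      using dx[of x] Qn(3,5) by blast+
  qed (use Pn Qn in auto)
  obtain l' where l': "\<And>n. l' \<in> nbhd (l n) (E n)"
  proof (rule tuples_limit[of l E])
    show "\<exists>n. x \<in> E n" "\<exists>n. \<forall>i<4. l n i x \<in> E n" for x
      using dx[of x] Qn(4,6) by blast+
  qed (use Pn Qn in auto)
  have "\<phi> k' x = \<psi> l' x" for x
  proof -
    \<comment> \<open>\<open>d n\<close> enters \<open>X\<close> at stage \<open>Suc n\<close>, and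
      the values on that set are frozen one round later.\<close>
    obtain n where "x \<in> X (Suc n)" using dx[of x] Qn(7) by blast
    then show ?thesis using Qn(8,9)[of "Suc n"] k' l' by simp
  qed
  moreover have "k' \<in> tuples" "l' \<in> tuples" using nbhd_tuples Pn k' l' by blast+
  ultimately show ?thesis by blast
qed

end

section \<open>From a common value to eight conjugates\<close>

theorem theorem1p2:
  fixes ar :: "'r \<Rightarrow> nat"
    and rel :: "'r \<Rightarrow> ('a :: countable) list \<Rightarrow> bool"
    and indep :: "'a set \<Rightarrow> 'a set \<Rightarrow> 'a set \<Rightarrow> bool"
    and g h :: "'a \<Rightarrow> 'a"
  assumes "relational_structure ar rel"
    and "homogeneous rel"
    and "stationary_weak_independence rel indep"
    and "g \<in> Aut rel"
    and "moves_almost_R_maximally rel indep g"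
    and "moves_almost_L_maximally rel indep g"
    and "moves_almost_R_maximally rel indep (inv g)"
    and "moves_almost_L_maximally rel indep (inv g)"
    and "h \<in> Aut rel"
  shows "\<exists>cs. length cs = 8 \<and> set cs \<subseteq> conjugates rel g \<and> h = foldr (\<circ>) cs id"
proof -
  interpret stationary_weak_independence rel indep by fact
  have g: "g \<in> Aut rel" "inv g \<in> Aut rel" "inv (inv g) = g" using assms(4) by simp_all
  have mov: "R_moving g" "L_moving g" "R_moving (inv g)" "L_moving (inv g)"
    using R_movingI L_movingI assms(5-8) g by blast+
  have mov': "R_moving (inv (inv g))" "L_moving (inv (inv g))" using mov g(3) by simp_all
  \<comment> \<open>Countability enters here, through the enumeration
    \<open>from_nat\<close>.\<close>
  obtain k l where k: "k \<in> tuples" and l: "l \<in> tuples"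
    and eq: "conj_product id g k = conj_product h (inv g) l"
    using nearly_open_common_value[OF conj_product_nearly_open[OF Aut_id mov]
        conj_product_dense[OF Aut_id mov] conj_product_nearly_open[OF assms(9) mov(3,4) mov']
        conj_product_dense[OF assms(9) mov(3,4) mov'] surj_from_nat] by blast
  \<comment> \<open>Cancelling the conjugates of \<open>inv g\<close> from the right reverses their
    order, so the indices descend for \<open>k\<close> and ascend for \<open>l\<close>.\<close>
  define cs where "cs = map (\<lambda>i. conj_by (k i) g) [3, 2, 1, 0] @ map (\<lambda>i. conj_by (l i) g) [0, 1, 2, 3]"
  have kl: "k i \<in> Aut rel" "l i \<in> Aut rel" if "i < 4" for i
    using k l that by (simp_all add: tuples_def)
  have cancel: "conj_by (l i) (inv g) (conj_by (l i) g x) = x" if "i < 4" for i x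
    using kl(2)[OF that] g(1) by (simp add: conj_by_apply)
  have "set cs \<subseteq> conjugates rel g"
    using kl by (auto simp: cs_def conjugates_def conj_by_def)
  moreover have "h x = foldr (\<circ>) cs id x" for x
  proof -
    define y where "y = foldr (\<circ>) (map (\<lambda>i. conj_by (l i) g) [0, 1, 2, 3]) id x"
    have "conj_product h (inv g) l y = h x"
      by (simp add: conj_product_def y_def cancel)
    moreover have "foldr (\<circ>) cs id x = conj_product id g k y"
      by (simp add: conj_product_def cs_def y_def)
    ultimately show ?thesis by (simp add: eq)
  qed
  ultimately show ?thesis by (intro exI[of _ cs]) (auto simp: cs_def)
qed

end
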